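(* Suppose that $G$ and $H$ are any graphs with $\delta(G)=\delta(H)=\operatorname{Z}(G)=\operatorname{Z}(H)=r$ for some $r\ge 2$. Let $X$ be any graph of order $|V(G)|+|V(H)|+r$ obtained from the disjoint union $G\sqcup H$ by choosing a minimum zero forcing set $B_G=\{v_1,\dots,v_r\}$ of $G$ of size $r$ and a minimum zero forcing set $B_H=\{w_1,\dots,w_r\}$ of $H$ of size $r$, adding $r$ new vertices $u_1,\dots,u_r$, making $u_1,\dots,u_r$ a complete graph with $\binom{r}{2}$ edges, and adding the $2r$ edges $v_iu_i$ and $u_iw_i$ for $i=1,\dots,r$. Then $\operatorname{Z}(X)=r$ and $\mathscr{Z}(X)$ is disconnected.
   Context: All graphs are finite, simple and undirected. $\delta(G)$ denotes the minimum degree of $G$. Zero forcing: vertices of a graph $G$ are colored blue or white; the color change rule says that a blue vertex $u$ can change the color of a white vertex $w$ to blue if $w$ is the unique white neighbor of $u$. A set $B\subseteq V(G)$ is a zero forcing set of $G$ if, starting with exactly the vertices of $B$ blue and applying the color change rule repeatedly, all vertices eventually become blue. The zero forcing number $\operatorname{Z}(G)$ is the minimum of $|B|$ over all zero forcing sets $B$ of $G$; a minimum zero forcing set is a zero forcing set $B$ with $|B|=\operatorname{Z}(G)$. The zero forcing graph $\mathscr{Z}(G)$ is the graph whose vertices are the minimum zero forcing sets of $G$, with two of them adjacent if and only if their symmetric difference has exactly two elements. *)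

theory Defs
  imports "Graph_Theory.Digraph_Component"
begin

text \<open>
  A finite simple undirected graph is an instance of \<^locale>\<open>pair_graph\<close>: a finite, loopfree,
  symmetric digraph without parallel arcs. An edge is represented by its two opposite arcs, so the
  degree of a vertex is its \<^const>\<open>out_degree\<close>.
\<close>

text \<open>For a graph without vertices the value is unspecified.\<close>

definition min_degree :: "'a pair_pre_digraph \<Rightarrow> nat" where
  "min_degree G = Min (out_degree G ` pverts G)"

text \<open>
  A set of vertices stands for the colouring in which exactly its members are blue;
  \<open>color_change G S T\<close> is one application of the rule: some \<open>u \<in> S\<close> whose only
  white neighbour is \<open>w\<close> turns \<open>w\<close> blue.
\<close>

definition color_change :: "'a pair_pre_digraph \<Rightarrow> 'a set \<Rightarrow> 'a set \<Rightarrow> bool" where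
  "color_change G S T \<longleftrightarrow> (\<exists>u\<in>S. \<exists>w. {x. u \<rightarrow>\<^bsub>G\<^esub> x \<and> x \<notin> S} = {w} \<and> T = insert w S)"

definition zero_forcing_set :: "'a pair_pre_digraph \<Rightarrow> 'a set \<Rightarrow> bool" where
  "zero_forcing_set G B \<longleftrightarrow> B \<subseteq> pverts G \<and> (color_change G)\<^sup>*\<^sup>* B (pverts G)"

definition zero_forcing_number :: "'a pair_pre_digraph \<Rightarrow> nat" where
  "zero_forcing_number G = (LEAST k. \<exists>B. zero_forcing_set G B \<and> card B = k)"

definition min_zero_forcing_set :: "'a pair_pre_digraph \<Rightarrow> 'a set \<Rightarrow> bool" where
  "min_zero_forcing_set G B \<longleftrightarrow> zero_forcing_set G B \<and> card B = zero_forcing_number G"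

definition zero_forcing_graph :: "'a pair_pre_digraph \<Rightarrow> 'a set pair_pre_digraph" where
  "zero_forcing_graph G = \<lparr>
     pverts = {B. min_zero_forcing_set G B},
     parcs = {(B, C). min_zero_forcing_set G B \<and> min_zero_forcing_set G C \<and>
                      card ((B - C) \<union> (C - B)) = 2} \<rparr>"

text \<open>
  The graph \<open>X\<close> built from the disjoint union of \<open>G\<close> and \<open>H\<close>: the vertices of \<open>G\<close> and
  \<open>H\<close> are tagged with \<^const>\<open>Inl\<close> and \<open>Inr \<circ> Inl\<close>, and the new vertex \<open>u\<^sub>i\<close> is
  \<open>Inr (Inr i)\<close>. The set of arcs listed after the two copies is closed under reversal by taking
  the union with its converse.
\<close>

definition clique_join ::
  "nat \<Rightarrow> 'a pair_pre_digraph \<Rightarrow> (nat \<Rightarrow> 'a) \<Rightarrow> 'b pair_pre_digraph \<Rightarrow> (nat \<Rightarrow> 'b)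
    \<Rightarrow> ('a + 'b + nat) pair_pre_digraph" where
  "clique_join r G v H w =
    (let g = Inl; h = (\<lambda>y. Inr (Inl y)); u = (\<lambda>i. Inr (Inr i));
         A = {(g (v i), u i) | i. i \<in> {1..r}} \<union> {(u i, h (w i)) | i. i \<in> {1..r}}
     in \<lparr> pverts = g ` pverts G \<union> h ` pverts H \<union> u ` {1..r},
          parcs = {(g x, g y) | x y. (x, y) \<in> parcs G}
                \<union> {(h x, h y) | x y. (x, y) \<in> parcs H}
                \<union> {(u i, u j) | i j. i \<in> {1..r} \<and> j \<in> {1..r} \<and> i \<noteq> j}
                \<union> A \<union> A\<inverse> \<rparr>)"

lemma pair_graph_zero_forcing_graph:
  assumes "pair_graph G"
  shows "pair_graph (zero_forcing_graph G)"
proof -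
  interpret pair_graph G by fact
  have fin: "finite {B. min_zero_forcing_set G B}"
    by (rule finite_subset[of _ "Pow (pverts G)"])
      (auto simp: min_zero_forcing_set_def zero_forcing_set_def pair_finite_verts)
  then have "finite (parcs (zero_forcing_graph G))"
    by (rule_tac finite_subset[OF _ finite_cartesian_product[OF fin fin]])
      (auto simp: zero_forcing_graph_def)
  with fin show ?thesis
    by unfold_locales
      (auto simp: zero_forcing_graph_def symmetric_def sym_def Un_commute)
qed

lemma pair_graph_clique_join:
  assumes "pair_graph G" "pair_graph H" "v ` {1..r} \<subseteq> pverts G" "w ` {1..r} \<subseteq> pverts H"
  shows "pair_graph (clique_join r G v H w)"
proof -
  interpret G: pair_graph G by fact
  interpret H: pair_graph H by fact
  let ?X = "clique_join r G v H w"
  have vw: "v i \<in> pverts G" "w i \<in> pverts H" if "Suc 0 \<le> i" "i \<le> r" for i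
    using assms(3,4) that by auto
  have V: "finite (pverts ?X)"
    by (simp add: clique_join_def Let_def G.pair_finite_verts H.pair_finite_verts)
  have sub: "parcs ?X \<subseteq> pverts ?X \<times> pverts ?X"
    by (auto simp: clique_join_def Let_def vw dest: G.in_arcsD1 G.in_arcsD2 H.in_arcsD1 H.in_arcsD2)
  have E: "finite (parcs ?X)"
    using finite_subset[OF sub] V by simp
  have sm: "symmetric ?X"
    by (auto simp: clique_join_def Let_def symmetric_def
      intro!: symI dest: G.arcs_symmetric H.arcs_symmetric)
  have loop: "fst e \<noteq> snd e" if "e \<in> parcs ?X" for e
    using that by (auto simp: clique_join_def Let_def dest: G.no_loops' H.no_loops')
  show ?thesis
    using V sub E sm loop by unfold_locales auto
qed

lemma card_pverts_clique_join:
  assumes "finite (pverts G)" "finite (pverts H)"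
  shows "card (pverts (clique_join r G v H w)) = card (pverts G) + card (pverts H) + r"
proof -
  let ?g = "Inl :: 'a \<Rightarrow> 'a + 'b + nat" and ?h = "\<lambda>y. Inr (Inl y) :: 'a + 'b + nat"
    and ?u = "\<lambda>i. Inr (Inr i) :: 'a + 'b + nat"
  have "card (?g ` pverts G \<union> ?h ` pverts H \<union> ?u ` {1..r})
      = card (?g ` pverts G) + card (?h ` pverts H) + card (?u ` {1..r})"
    using assms by (subst card_Un_disjoint | force)+
  then show ?thesis
    by (simp add: clique_join_def Let_def card_image inj_on_def)
qed

end

theory Submission
  imports Defs
begin

text \<open>
  The first vertex to force, together with all but one of its neighbours, is blue from the start.
  Hence a zero forcing set has at least minimum degree many elements, and one of size exactly \<open>r\<close>
  in \<open>X\<close> is the closed neighbourhood minus one vertex of a vertex of degree \<open>r\<close>. The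
  \<open>u\<^sub>i\<close>, \<open>v\<^sub>i\<close>, \<open>w\<^sub>i\<close> have degree above \<open>r\<close>, so such a set lies
  inside \<open>G\<close> or inside \<open>H\<close>, and sets of the two kinds are never adjacent. Both kinds occur:
  running the forces of \<open>B\<^sub>G\<close> backwards colours \<open>G\<close> without any force by a
  \<open>v\<^sub>i\<close>; then \<open>v\<^sub>i\<close> forces \<open>u\<^sub>i\<close>, \<open>u\<^sub>i\<close> forces
  \<open>w\<^sub>i\<close>, and \<open>B\<^sub>H\<close> forces \<open>H\<close>.
\<close>

section \<open>Forcing by a restricted set of vertices; neighbourhoods as relational images\<close>

text \<open>Only members of \<open>U\<close> may force. The restriction matters in \<open>X\<close>,
  where each \<open>v i\<close> has an extra white neighbour and so cannot force as it would in
  \<open>G\<close> alone.\<close>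

definition color_change_by :: "'a set \<Rightarrow> 'a pair_pre_digraph \<Rightarrow> 'a set \<Rightarrow> 'a set \<Rightarrow> bool" where
  "color_change_by U G S T \<longleftrightarrow> (\<exists>u\<in>S \<inter> U. \<exists>w. parcs G `` {u} - S = {w} \<and> T = insert w S)"

lemma color_change_eq_by_UNIV: "color_change G = color_change_by UNIV G"
proof -
  have "{x. u \<rightarrow>\<^bsub>G\<^esub> x \<and> x \<notin> S} = parcs G `` {u} - S" for u S
    by (auto simp: arcs_ends_conv)
  then show ?thesis
    by (simp add: fun_eq_iff color_change_def color_change_by_def)
qed

lemma color_changeI:
  assumes "u \<in> S" "parcs G `` {u} - S = {w}"
  shows "color_change G S (insert w S)"
  using assms by (auto simp: color_change_eq_by_UNIV color_change_by_def)

lemma color_change_insertI: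
  assumes "u \<in> S" "parcs G `` {u} = insert w N" "N \<subseteq> S" "w \<notin> S"
  shows "color_change G S (insert w S)"
  using assms by (intro color_changeI) auto

lemma out_degree_eq_card_Image:
  fixes G :: "'a pair_pre_digraph"
  shows "out_degree G u = card (parcs G `` {u})"
proof -
  have "out_arcs G u = Pair u ` (parcs G `` {u})"
    by (auto simp: out_arcs_def)
  then show ?thesis
    by (simp add: out_degree_def card_image inj_on_def)
qed

lemma (in pair_graph) min_degree_le:
  assumes "x \<in> pverts G"
  shows "min_degree G \<le> card (parcs G `` {x})"
  using assms by (simp add: min_degree_def pair_finite_verts flip: out_degree_eq_card_Image)

lemma (in pair_graph) Image_subset_pverts: "parcs G `` S \<subseteq> pverts G"
  using in_arcsD2 by auto

lemma (in pair_graph) finite_Image: "finite (parcs G `` S)"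
  using Image_subset_pverts pair_finite_verts finite_subset by blast

section \<open>Reversing a forcing process\<close>

text \<open>
  Reversal: \<open>A\<close> consists of the blue vertices that have not forced yet, and undoing the forces one
  at a time, each \<open>w\<close> forces back the vertex that forced it.
\<close>

lemma (in pair_graph) color_change_reverse:
  assumes "(color_change G)\<^sup>*\<^sup>* B S" "B \<subseteq> pverts G"
  shows "\<exists>A\<subseteq>S. B \<subseteq> S \<and> S \<subseteq> pverts G \<and> card A = card B \<and> parcs G `` (S - A) \<subseteq> S \<and>
    (color_change_by (- B) G)\<^sup>*\<^sup>* (pverts G - (S - A)) (pverts G)"
  using assms(1)
proof induction
  case base
  \<comment> \<open>Before any force, \<open>A\<close> is all of \<open>B\<close>; the reverse
    process starts and ends at the full vertex set.\<close>
  then show ?case using assms(2) by (intro exI[of _ B]) auto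
next
  case (step S T)
  then obtain A where A: "A \<subseteq> S" "B \<subseteq> S" "S \<subseteq> pverts G" "card A = card B"
      "parcs G `` (S - A) \<subseteq> S"
      "(color_change_by (- B) G)\<^sup>*\<^sup>* (pverts G - (S - A)) (pverts G)"
    by blast
  obtain u w where uw: "u \<in> S" "parcs G `` {u} - S = {w}" and T: "T = insert w S"
    using step.hyps(2) by (auto simp: color_change_eq_by_UNIV color_change_by_def)
  have w: "(u, w) \<in> parcs G" "w \<notin> S" "w \<in> pverts G"
    using uw in_arcsD2 by auto
  have wu: "(w, u) \<in> parcs G"
    using w(1) arcs_symmetric by blast
  \<comment> \<open>A vertex that has already forced has all its neighbours in \<open>S\<close>, but
    \<open>u\<close> still sees the white vertex \<open>w\<close>.\<close>
  have u: "u \<in> A"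
    using A(5) uw(1) w by auto
  \<comment> \<open>\<open>u\<close> has now forced and leaves; the new blue vertex \<open>w\<close>
    has not forced yet and enters.\<close>
  define A' where "A' = insert w (A - {u})"
  have "finite A"
    using A pair_finite_verts by (meson finite_subset)
  then have "card A' = card A"
    using u w A(1) card.remove[of A u] unfolding A'_def by (subst card_insert_disjoint) auto
  moreover have diff: "T - A' = insert u (S - A)"
    using T A'_def u w A(1) by auto
  moreover have "parcs G `` {u} \<subseteq> T"
    using uw T by auto
  then have "parcs G `` (T - A') \<subseteq> T"
    using diff A(5) T by auto
  moreover have "A' \<subseteq> T"
    using T A'_def A(1) by auto
  moreover have "B \<subseteq> T" "T \<subseteq> pverts G"
    using T A w by auto
  moreover have "color_change_by (- B) G (pverts G - (T - A')) (pverts G - (S - A))"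
    unfolding color_change_by_def
  proof (intro bexI exI conjI)
    show "parcs G `` {w} - (pverts G - (T - A')) = {u}"
    proof -
      \<comment> \<open>The white vertices of the reverse process are \<open>u\<close> and those of
        \<open>S - A\<close>. The latter have all neighbours in \<open>S\<close>, so by symmetry
        none is adjacent to \<open>w\<close>.\<close>
      have "x = u" if "(w, x) \<in> parcs G" "x \<in> insert u (S - A)" for x
        using that A(5) w(2) arcs_symmetric by blast
      then show ?thesis
        using wu in_arcsD2 diff by auto
    qed
    show "pverts G - (S - A) = insert u (pverts G - (T - A'))"
      using diff u uw(1) A(3) by auto
    \<comment> \<open>The reverse forcer \<open>w\<close> was white when \<open>B\<close> was
      already blue, hence lies outside \<open>B\<close>.\<close>
    show "w \<in> (pverts G - (T - A')) \<inter> - B"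
      using w A'_def A(2) by auto
  qed
  ultimately show ?case
    using A by (metis (no_types, lifting) converse_rtranclp_into_rtranclp)
qed

lemma (in pair_graph) zero_forcing_set_reverse:
  assumes "zero_forcing_set G B"
  obtains A where "A \<subseteq> pverts G" "card A = card B" "(color_change_by (- B) G)\<^sup>*\<^sup>* A (pverts G)"
proof -
  obtain A where A: "A \<subseteq> pverts G" "card A = card B"
      "(color_change_by (- B) G)\<^sup>*\<^sup>* (pverts G - (pverts G - A)) (pverts G)"
    using color_change_reverse[of B "pverts G"] assms by (auto simp: zero_forcing_set_def)
  moreover have "pverts G - (pverts G - A) = A"
    using A(1) by auto
  ultimately show thesis using that by simp
qed

section \<open>Transferring forces to a larger graph; the first force\<close>

text \<open>By \<open>nb\<close>, once \<open>D\<close> is blue a vertex of \<open>U\<close> sees in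
  \<open>X\<close> no white vertices other than copies of its white neighbours in \<open>G\<close>,
  so each of its forces can be repeated in \<open>X\<close>.\<close>

lemma color_change_embed:
  assumes "(color_change_by U G)\<^sup>*\<^sup>* S T" "inj f" "D \<inter> range f = {}"
    and nb: "\<And>x. x \<in> U \<Longrightarrow> parcs X `` {f x} - D = f ` (parcs G `` {x})"
  shows "(color_change X)\<^sup>*\<^sup>* (f ` S \<union> D) (f ` T \<union> D)"
  using assms(1)
proof induction
  case (step S T)
  then obtain u w where u: "u \<in> S" "u \<in> U" and w: "parcs G `` {u} - S = {w}"
    and T: "T = insert w S"
    by (auto simp: color_change_by_def)
  have "parcs X `` {f u} - (f ` S \<union> D) = f ` (parcs G `` {u}) - f ` S"
    using nb[OF u(2)] by auto
  also have "\<dots> = {f w}"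
    using w assms(2) by (metis image_set_diff image_insert image_empty)
  finally have "color_change X (f ` S \<union> D) (f ` T \<union> D)"
    using color_changeI[of "f u" "f ` S \<union> D" X "f w"] u T by simp
  with step.IH show ?case by simp
qed simp

lemma zero_forcing_set_first_force:
  assumes "zero_forcing_set G B" "B \<noteq> pverts G"
  obtains u w where "u \<in> B" "parcs G `` {u} - B = {w}"
proof -
  obtain T where "color_change G B T"
    using assms by (metis zero_forcing_set_def converse_rtranclpE)
  then show thesis
    using that by (auto simp: color_change_eq_by_UNIV color_change_by_def)
qed

section \<open>Zero forcing sets of size \<open>r\<close> inside one side of
  \<open>X\<close>\<close>

text \<open>Abstract over the tagging in \<open>clique_join\<close>, so that \<open>G\<close> and \<open>H\<close> become interchangeable.\<close>

locale clique_bridge = G: pair_graph G + H: pair_graph H + X: pair_graph X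
  for G :: "'a pair_pre_digraph" and H :: "'b pair_pre_digraph" and X :: "'c pair_pre_digraph" +
  fixes r :: nat and v :: "nat \<Rightarrow> 'a" and w :: "nat \<Rightarrow> 'b"
    and g :: "'a \<Rightarrow> 'c" and h :: "'b \<Rightarrow> 'c" and u :: "nat \<Rightarrow> 'c"
  assumes inj_g: "inj g" and inj_h: "inj h" and inj_u: "inj u"
    and g_neq_h: "g x \<noteq> h y" and g_neq_u: "g x \<noteq> u i" and h_neq_u: "h y \<noteq> u i"
    and verts: "pverts X = g ` pverts G \<union> h ` pverts H \<union> u ` {1..r}"
    and nb_g: "parcs X `` {g x} = g ` (parcs G `` {x}) \<union> u ` {i \<in> {1..r}. v i = x}"
    and nb_h: "parcs X `` {h y} = h ` (parcs H `` {y}) \<union> u ` {i \<in> {1..r}. w i = y}"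
    and nb_u: "i \<in> {1..r} \<Longrightarrow> parcs X `` {u i} = {g (v i), h (w i)} \<union> u ` ({1..r} - {i})"
    and inj_v: "inj_on v {1..r}" and inj_w: "inj_on w {1..r}"
    and zfs_v: "zero_forcing_set G (v ` {1..r})" and zfs_w: "zero_forcing_set H (w ` {1..r})"
    and r_pos: "r > 0"
    and deg_G: "x \<in> pverts G \<Longrightarrow> r \<le> card (parcs G `` {x})"
    and deg_H: "y \<in> pverts H \<Longrightarrow> r \<le> card (parcs H `` {y})"
begin

text \<open>Lets every result about the side of \<open>G\<close> be reused for the side of
  \<open>H\<close>.\<close>

lemma swap: "clique_bridge H G X r w v h g u"
  using inj_g inj_h inj_u g_neq_h g_neq_u h_neq_u verts nb_g nb_h nb_u inj_v inj_w zfs_v zfs_w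
    r_pos deg_G deg_H
  by unfold_locales (auto simp: eq_commute[of "h _" "g _"])

lemma card_g: "card (g ` S) = card S" and card_u: "card (u ` K) = card K"
  using inj_g inj_u by (meson card_image inj_on_subset subset_UNIV)+

lemma v_in_pverts: "i \<in> {1..r} \<Longrightarrow> v i \<in> pverts G"
  using zfs_v by (auto simp: zero_forcing_set_def)

text \<open>With \<open>G\<close> blue and \<open>v\<close> injective, the only white neighbour of
  \<open>g (v i)\<close> is \<open>u i\<close>; the forces are made in the order of the
  indices.\<close>

lemma forcing_u:
  assumes "k \<le> r"
  shows "(color_change X)\<^sup>*\<^sup>* (g ` pverts G) (g ` pverts G \<union> u ` {1..k})"
  using assms
proof (induction k)
  case (Suc k)
  let ?S = "g ` pverts G \<union> u ` {1..k}"
  have "{i \<in> {1..r}. v i = v (Suc k)} = {Suc k}"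
    using Suc.prems by (auto dest: inj_onD[OF inj_v])
  then have "parcs X `` {g (v (Suc k))} = insert (u (Suc k)) (g ` (parcs G `` {v (Suc k)}))"
    by (simp add: nb_g)
  moreover have "u (Suc k) \<notin> ?S"
    using g_neq_u[symmetric] by (auto simp: inj_image_mem_iff[OF inj_u])
  moreover have "g ` (parcs G `` {v (Suc k)}) \<subseteq> ?S"
    using G.Image_subset_pverts by blast
  moreover have "g (v (Suc k)) \<in> ?S"
    using Suc.prems v_in_pverts by simp
  ultimately have "color_change X ?S (insert (u (Suc k)) ?S)"
    by (intro color_change_insertI)
  moreover have "insert (u (Suc k)) ?S = g ` pverts G \<union> u ` {1..Suc k}"
    by (auto simp: atLeastAtMostSuc_conv)
  ultimately show ?case
    using Suc by (metis Suc_leD rtranclp.rtrancl_into_rtrancl)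
qed simp

text \<open>The clique and \<open>g (v i)\<close> are blue, which leaves \<open>h (w i)\<close> as
  the only white neighbour of \<open>u i\<close>.\<close>

lemma forcing_w:
  assumes "k \<le> r"
  defines "D \<equiv> g ` pverts G \<union> u ` {1..r}"
  shows "(color_change X)\<^sup>*\<^sup>* D (h ` w ` {1..k} \<union> D)"
  using assms(1)
proof (induction k)
  case (Suc k)
  let ?S = "h ` w ` {1..k} \<union> D"
  have i: "Suc k \<in> {1..r}" using Suc.prems by simp
  have "parcs X `` {u (Suc k)} =
      insert (h (w (Suc k))) (insert (g (v (Suc k))) (u ` ({1..r} - {Suc k})))"
    using nb_u[OF i] by auto
  moreover have "h (w (Suc k)) \<notin> ?S"
  proof -
    have "w (Suc k) \<notin> w ` {1..k}"
      using i by (auto dest: inj_onD[OF inj_w])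
    moreover have "h (w (Suc k)) \<notin> D"
      using g_neq_h[symmetric] h_neq_u by (auto simp: D_def)
    ultimately show ?thesis
      using inj_h by (simp add: inj_image_mem_iff)
  qed
  moreover have "insert (g (v (Suc k))) (u ` ({1..r} - {Suc k})) \<subseteq> ?S"
    using v_in_pverts[OF i] by (auto simp: D_def)
  moreover have "u (Suc k) \<in> ?S"
    using i by (auto simp: D_def)
  ultimately have "color_change X ?S (insert (h (w (Suc k))) ?S)"
    by (intro color_change_insertI)
  moreover have "insert (h (w (Suc k))) ?S = h ` w ` {1..Suc k} \<union> D"
    by (auto simp: atLeastAtMostSuc_conv)
  ultimately show ?case
    using Suc by (metis Suc_leD rtranclp.rtrancl_into_rtrancl)
qed simp

lemma zero_forcing_set_exists:
  obtains B where "B \<subseteq> g ` pverts G" "card B = r" "zero_forcing_set X B"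
proof -
  obtain A where A: "A \<subseteq> pverts G" "card A = card (v ` {1..r})"
      "(color_change_by (- v ` {1..r}) G)\<^sup>*\<^sup>* A (pverts G)"
    using G.zero_forcing_set_reverse[OF zfs_v] by blast
  let ?D = "g ` pverts G \<union> u ` {1..r}"
  \<comment> \<open>Vertices other than the \<open>v i\<close> have no neighbours outside the copy
    of \<open>G\<close>, so the extra blue set can be empty.\<close>
  have "(color_change X)\<^sup>*\<^sup>* (g ` A \<union> {}) (g ` pverts G \<union> {})"
    using A(3) inj_g by (rule color_change_embed) (auto simp: nb_g)
  then have "(color_change X)\<^sup>*\<^sup>* (g ` A) (g ` pverts G)"
    by simp
  also have "(color_change X)\<^sup>*\<^sup>* \<dots> ?D"
    by (rule forcing_u) simp
  also have "(color_change X)\<^sup>*\<^sup>* \<dots> (h ` w ` {1..r} \<union> ?D)"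
    by (rule forcing_w) simp
  also have "(color_change X)\<^sup>*\<^sup>* \<dots> (h ` pverts H \<union> ?D)"
  proof (rule color_change_embed)
    \<comment> \<open>All \<open>u i\<close> are blue by now, so every vertex of \<open>H\<close>,
      including the \<open>w i\<close>, may force.\<close>
    show "(color_change_by UNIV H)\<^sup>*\<^sup>* (w ` {1..r}) (pverts H)"
      using zfs_w by (simp add: zero_forcing_set_def color_change_eq_by_UNIV)
    show "?D \<inter> range h = {}"
      using g_neq_h h_neq_u by (auto, metis)
    show "parcs X `` {h y} - ?D = h ` (parcs H `` {y})" for y
      using g_neq_h h_neq_u by (auto simp: nb_h) metis+
  qed (rule inj_h)
  also have "h ` pverts H \<union> ?D = pverts X"
    using verts by auto
  finally have "zero_forcing_set X (g ` A)"
    using A(1) verts by (auto simp: zero_forcing_set_def)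
  moreover have "card (g ` A) = r"
    using A(2) inj_v by (simp add: card_g card_image)
  ultimately show thesis
    using that A(1) by blast
qed

section \<open>Lower bound and location of small zero forcing sets\<close>

text \<open>\<open>B\<close> contains \<open>z\<close> and all its neighbours but \<open>t\<close>.
  Trading \<open>t\<close> for \<open>z\<close> keeps the count equal to the degree, and equality of
  sizes leaves no room for further elements of \<open>B\<close>.\<close>

lemma card_nb_le:
  assumes "finite B" "z \<in> B" "parcs X `` {z} - B = {t}"
  shows "card (parcs X `` {z}) \<le> card B"
    and "card (parcs X `` {z}) = card B \<Longrightarrow> B \<subseteq> insert z (parcs X `` {z})"
proof -
  let ?C = "insert z (parcs X `` {z} - {t})"
  have sub: "?C \<subseteq> B" using assms by auto
  have "z \<notin> parcs X `` {z}" using X.no_loops' by auto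
  moreover have "t \<in> parcs X `` {z}" using assms by auto
  ultimately have "card ?C = card (parcs X `` {z})"
    using X.finite_Image[of "{z}"] card.remove[of "parcs X `` {z}" t] by simp
  then show "card (parcs X `` {z}) \<le> card B"
    using card_mono[OF assms(1) sub] by simp
  show "B \<subseteq> insert z (parcs X `` {z})" if "card (parcs X `` {z}) = card B"
    using card_subset_eq[OF assms(1) sub] that \<open>card ?C = _\<close> by auto
qed

text \<open>The degree of \<open>g x\<close> is at least \<open>r\<close> plus the number of its
  neighbours \<open>u i\<close>, yet at most \<open>card B\<close>. Hence there are no such
  neighbours, and the closed neighbourhood, which contains \<open>B\<close>, stays in the copy of
  \<open>G\<close>.\<close>

lemma small_forced_from_G:
  assumes "finite B" "card B \<le> r" "g x \<in> B" "parcs X `` {g x} - B = {t}" "x \<in> pverts G"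
  shows "card B = r \<and> B \<subseteq> g ` pverts G"
proof -
  note le = card_nb_le[OF assms(1,3,4)]
  let ?I = "{i \<in> {1..r}. v i = x}"
  have "card (parcs X `` {g x}) = card (g ` (parcs G `` {x})) + card (u ` ?I)"
    unfolding nb_g using G.finite_Image[of "{x}"] g_neq_u
    by (intro card_Un_disjoint) auto
  also have "\<dots> = card (parcs G `` {x}) + card ?I"
    by (simp add: card_g card_u)
  finally have "card ?I = 0" "card B = r" "card (parcs X `` {g x}) = card B"
    using deg_G[OF assms(5)] le(1) assms(2) by linarith+
  then have I: "?I = {}" by (subst (asm) card_0_eq) auto
  have "parcs X `` {g x} = g ` (parcs G `` {x})"
    unfolding nb_g I by simp
  then show ?thesis
    using le(2) \<open>card (parcs X `` {g x}) = card B\<close> \<open>card B = r\<close> assms(5)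
      G.Image_subset_pverts[of "{x}"]
    by blast
qed

lemma small_zero_forcing_set:
  assumes "zero_forcing_set X B" "card B \<le> r"
  shows "card B = r \<and> (B \<subseteq> g ` pverts G \<or> B \<subseteq> h ` pverts H)"
proof -
  have finB: "finite B" and subB: "B \<subseteq> pverts X"
    using assms(1) X.pair_finite_verts by (auto simp: zero_forcing_set_def intro: finite_subset)
  \<comment> \<open>\<open>g (v 1)\<close> and the \<open>u i\<close> are \<open>r + 1\<close>
    vertices, so \<open>B\<close> is not everything and some first force exists.\<close>
  have "v 1 \<in> pverts G"
    using r_pos by (intro v_in_pverts) simp
  then have "insert (g (v 1)) (u ` {1..r}) \<subseteq> pverts X"
    unfolding verts by simp
  from card_mono[OF X.pair_finite_verts this]
  have "card (insert (g (v 1)) (u ` {1..r})) \<le> card (pverts X)" .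
  moreover have "g (v 1) \<notin> u ` {1..r}"
    using g_neq_u by blast
  moreover have "card (u ` {1..r}) = r"
    by (simp add: card_u)
  ultimately have "r < card (pverts X)"
    by simp
  then have "B \<noteq> pverts X" using assms(2) by auto
  then obtain z t where zt: "z \<in> B" "parcs X `` {z} - B = {t}"
    using zero_forcing_set_first_force[OF assms(1)] by blast
  consider x where "x \<in> pverts G" "z = g x" | y where "y \<in> pverts H" "z = h y"
    | i where "i \<in> {1..r}" "z = u i"
    using zt(1) subB verts by blast
  then show ?thesis
  proof cases
    case 1
    then show ?thesis using small_forced_from_G[OF finB assms(2)] zt by blast
  next
    case 2
    then show ?thesis
      using clique_bridge.small_forced_from_G[OF swap finB assms(2)] zt by blast
  next
    case 3
    \<comment> \<open>A clique vertex has degree \<open>r + 1\<close>, too large to force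
      first.\<close>
    have "card (parcs X `` {z}) = card {g (v i), h (w i)} + card (u ` ({1..r} - {i}))"
      unfolding 3(2) nb_u[OF 3(1)] using g_neq_u h_neq_u by (intro card_Un_disjoint) auto
    also have "\<dots> = 2 + (r - 1)"
      using g_neq_h 3(1) by (simp add: card_u)
    finally show ?thesis
      using card_nb_le(1)[OF finB zt] assms(2) by simp
  qed
qed

section \<open>Zero forcing number and disconnectedness\<close>

lemma zero_forcing_number_eq: "zero_forcing_number X = r"
  unfolding zero_forcing_number_def
proof (rule Least_equality)
  show "\<exists>B. zero_forcing_set X B \<and> card B = r"
    using zero_forcing_set_exists by blast
  show "r \<le> k" if "\<exists>B. zero_forcing_set X B \<and> card B = k" for k
  proof (rule ccontr)
    assume "\<not> r \<le> k"
    then show False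
      using that small_zero_forcing_set by fastforce
  qed
qed

text \<open>Sets on opposite sides are disjoint, so their symmetric difference has
  \<open>2 * r\<close>, hence at least 4, elements.\<close>

lemma adjacent_same_side:
  assumes "(B, C) \<in> parcs (zero_forcing_graph X)" "B \<subseteq> g ` pverts G" "r \<ge> 2"
  shows "C \<subseteq> g ` pverts G"
proof (rule ccontr)
  assume C: "\<not> C \<subseteq> g ` pverts G"
  have card: "card B = r" "card C = r" "card ((B - C) \<union> (C - B)) = 2" and "zero_forcing_set X C"
    using assms(1) by (auto simp: zero_forcing_graph_def min_zero_forcing_set_def
        zero_forcing_number_eq)
  then have "C \<subseteq> h ` pverts H"
    using C small_zero_forcing_set[of C] by simp
  then have "B \<inter> C = {}"
    using assms(2) g_neq_h by blast
  moreover have "finite B" "finite C"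
    using card assms(3) by (auto intro: card_ge_0_finite)
  moreover have "(B - C) \<union> (C - B) = B \<union> C"
    using \<open>B \<inter> C = {}\<close> by auto
  ultimately show False
    using card assms(3) by (simp add: card_Un_disjoint)
qed

lemma zero_forcing_graph_disconnected:
  assumes "r \<ge> 2"
  shows "\<not> Digraph_Component.connected (zero_forcing_graph X)"
proof
  interpret Z: pair_graph "zero_forcing_graph X"
    by (rule pair_graph_zero_forcing_graph) unfold_locales
  assume conn: "Digraph_Component.connected (zero_forcing_graph X)"
  obtain B where B: "B \<subseteq> g ` pverts G" "card B = r" "zero_forcing_set X B"
    using zero_forcing_set_exists by blast
  obtain C where C: "C \<subseteq> h ` pverts H" "card C = r" "zero_forcing_set X C"
    using clique_bridge.zero_forcing_set_exists[OF swap] by blast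
  have "B \<in> pverts (zero_forcing_graph X)" "C \<in> pverts (zero_forcing_graph X)"
    using B(2,3) C(2,3)
    by (simp_all add: zero_forcing_graph_def min_zero_forcing_set_def zero_forcing_number_eq)
  \<comment> \<open>\<open>connected\<close> refers to the symmetrised digraph; adjacency here is
    symmetric already, so it yields directed reachability.\<close>
  moreover have "strongly_connected (zero_forcing_graph X)"
    using Z.sym_arcs conn by (rule Z.symmetric_connected_imp_strongly_connected)
  ultimately have "B \<rightarrow>\<^sup>*\<^bsub>zero_forcing_graph X\<^esub> C"
    by (simp add: strongly_connected_def)
  then have "C \<subseteq> g ` pverts G"
  proof (induction rule: Z.reachable_induct)
    case (step x y)
    then show ?case
      using adjacent_same_side assms by (auto simp: arcs_ends_conv)
  qed (rule B(1))
  \<comment> \<open>\<open>C\<close> would lie in both copies, which are disjoint.\<close>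
  then have "C = {}"
    using C(1) g_neq_h by blast
  then show False
    using C(2) r_pos by simp
qed

end

section \<open>The concrete construction as an instance\<close>

lemma clique_bridge_clique_join:
  assumes "pair_graph G" "pair_graph H" "r \<ge> 2"
    and "min_degree G = r" "min_degree H = r"
    and "zero_forcing_set G B\<^sub>G" "bij_betw v {1..r} B\<^sub>G"
    and "zero_forcing_set H B\<^sub>H" "bij_betw w {1..r} B\<^sub>H"
  shows "clique_bridge G H (clique_join r G v H w) r v w Inl (\<lambda>y. Inr (Inl y)) (\<lambda>i. Inr (Inr i))"
proof -
  interpret G: pair_graph G by fact
  interpret H: pair_graph H by fact
  have im: "v ` {1..r} = B\<^sub>G" "w ` {1..r} = B\<^sub>H"
    and inj: "inj_on v {1..r}" "inj_on w {1..r}"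
    using assms(7,9) by (simp_all add: bij_betw_def)
  have sub: "v ` {1..r} \<subseteq> pverts G" "w ` {1..r} \<subseteq> pverts H"
    using assms(6,8) unfolding im by (simp_all add: zero_forcing_set_def)
  interpret X: pair_graph "clique_join r G v H w"
    using assms(1,2) sub by (rule pair_graph_clique_join)
  show ?thesis
  proof
    show "inj_on v {1..r}" "inj_on w {1..r}"
      by fact+
    show "zero_forcing_set G (v ` {1..r})" "zero_forcing_set H (w ` {1..r})"
      unfolding im by fact+
    show "r \<le> card (parcs G `` {x})" if "x \<in> pverts G" for x
      using G.min_degree_le[OF that] assms(4) by simp
    show "r \<le> card (parcs H `` {y})" if "y \<in> pverts H" for y
      using H.min_degree_le[OF that] assms(5) by simp
    let ?X = "clique_join r G v H w"
    show "parcs ?X `` {Inl x} = Inl ` (parcs G `` {x}) \<union> (\<lambda>i. Inr (Inr i)) ` {i \<in> {1..r}. v i = x}"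
      for x by (auto simp: clique_join_def Let_def)
    show "parcs ?X `` {Inr (Inl y)} =
        (\<lambda>y. Inr (Inl y)) ` (parcs H `` {y}) \<union> (\<lambda>i. Inr (Inr i)) ` {i \<in> {1..r}. w i = y}" for y
      by (auto simp: clique_join_def Let_def)
    show "parcs ?X `` {Inr (Inr i)} =
        {Inl (v i), Inr (Inl (w i))} \<union> (\<lambda>i. Inr (Inr i)) ` ({1..r} - {i})" if "i \<in> {1..r}" for i
      using that by (auto simp: clique_join_def Let_def)
    show "pverts ?X = Inl ` pverts G \<union> (\<lambda>y. Inr (Inl y)) ` pverts H \<union> (\<lambda>i. Inr (Inr i)) ` {1..r}"
      by (simp add: clique_join_def Let_def)
  qed (use assms(3) in \<open>simp_all add: inj_on_def\<close>)
qed

theorem proposition3p4: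
  fixes G :: "'a pair_pre_digraph" and H :: "'b pair_pre_digraph"
    and X :: "('a + 'b + nat) pair_pre_digraph"
    and v :: "nat \<Rightarrow> 'a" and w :: "nat \<Rightarrow> 'b" and r :: nat
  assumes "pair_graph G" and "pair_graph H"
    and "r \<ge> 2"
    and "min_degree G = r" and "min_degree H = r"
    and "zero_forcing_number G = r" and "zero_forcing_number H = r"
    and "min_zero_forcing_set G B\<^sub>G" and "bij_betw v {1..r} B\<^sub>G"
    and "min_zero_forcing_set H B\<^sub>H" and "bij_betw w {1..r} B\<^sub>H"
    and "X = clique_join r G v H w"
  shows "zero_forcing_number X = r \<and> \<not> Digraph_Component.connected (zero_forcing_graph X)"
proof -
  interpret clique_bridge G H X r v w Inl "\<lambda>y. Inr (Inl y)" "\<lambda>i. Inr (Inr i)"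
    unfolding assms(12) using assms(8,10)
    by (intro clique_bridge_clique_join[OF assms(1-5) _ assms(9) _ assms(11)])
      (simp_all add: min_zero_forcing_set_def)
  show ?thesis
    using zero_forcing_number_eq zero_forcing_graph_disconnected assms(3) by blast
qed

end
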